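(* Let $(X_n)_{n=1}^\infty$ be a sequence of topological spaces, let $a\in\prod_{n=1}^\infty X_n$, let $E=\sigma(a)$, and let $f:(E,\tau)\to\mathbb R$ be a function. (1) If $f$ is strongly separately continuous, then $f\in B_1^d(E,\mathbb R)$. (2) If $f$ is separately continuous and $X_n$ is metrizable for every $n\in\mathbb N$, then $f\in B_{\omega_0}^d(E,\mathbb R)$.
   Context: For $a=(a_n)_n\in X=\prod_{n=1}^\infty X_n$, $\sigma(a)=\{x=(x_n)_n\in X: \{n\in\mathbb N:x_n\ne a_n\}\text{ is finite}\}$. $\tau$ denotes the Tychonoff product topology on $X$ and also the subspace topology it induces on $E=\sigma(a)$; the Baire classes of functions on $E$ are taken with respect to $(E,\tau)$. For $x,b\in E$ and $k\in\mathbb N$, $x_k^b$ denotes the point whose $k$-th coordinate is $b_k$ and whose $n$-th coordinate is $x_n$ for all $n\neq k$ (it belongs to $E$). The function $f:(E,\tau)\to\mathbb R$ is strongly separately continuous if for every $b\in E$ and every $k\in\mathbb N$, $\lim_{x\to b}|f(x)-f(x_k^b)|=0$, the limit being taken in $(E,\tau)$. The function $f$ is separately continuous if for every $b\in E$ and every $k\in\mathbb N$ the function $X_k\to\mathbb R$ sending $u\in X_k$ to the value of $f$ at the point obtained from $b$ by replacing the $k$-th coordinate by $u$ is continuous at $b_k$. Baire classes: for topological spaces $Z,Y$, $B_0(Z,Y)$ is the set of all continuous maps $Z\to Y$; for $0<\alpha<\omega_1$, $B_\alpha(Z,Y)$ is the set of all maps $Z\to Y$ that are pointwise limits of a sequence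 of maps $f_n\in B_{\xi_n}(Z,Y)$ with $\xi_n<\alpha$. For $1\le\alpha<\omega_1$, the $\alpha$-th stable Baire class $B_\alpha^d(Z,Y)$ is the set of all maps $f:Z\to Y$ for which there is a sequence of maps $f_n\in B_{\alpha_n}(Z,Y)$ with $\alpha_n<\alpha$ such that for every $z\in Z$ there exists $N\in\mathbb N$ with $f_n(z)=f(z)$ for all $n\ge N$. $\omega_0$ is the first infinite ordinal. *)

theory Defs
  imports "HOL-Analysis.Analysis"
begin

text \<open>
  The index set of the sequence of spaces is \<^typ>\<open>nat\<close>, starting at \<open>0\<close>. All spaces are given as
  topologies on subsets of one type; since the carriers are arbitrary, this is no restriction.
  Only the values of \<open>f\<close> on \<open>sigma_prod X a\<close> are relevant below.
\<close>

definition sigma_prod :: "(nat \<Rightarrow> 'a topology) \<Rightarrow> (nat \<Rightarrow> 'a) \<Rightarrow> (nat \<Rightarrow> 'a) set" where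
  "sigma_prod X a =
    {x \<in> topspace (product_topology X UNIV). finite {n. x n \<noteq> a n}}"

definition sigma_top :: "(nat \<Rightarrow> 'a topology) \<Rightarrow> (nat \<Rightarrow> 'a) \<Rightarrow> (nat \<Rightarrow> 'a) topology" where
  "sigma_top X a = subtopology (product_topology X UNIV) (sigma_prod X a)"

text \<open>
  The filter \<^const>\<open>atin\<close> is punctured at \<open>b\<close>; this does not matter, because the function whose limit
  is taken vanishes at \<open>b\<close>.
\<close>
definition strongly_separately_continuous ::
    "(nat \<Rightarrow> 'a topology) \<Rightarrow> (nat \<Rightarrow> 'a) \<Rightarrow> ((nat \<Rightarrow> 'a) \<Rightarrow> real) \<Rightarrow> bool" where
  "strongly_separately_continuous X a f \<longleftrightarrow>
    (\<forall>b \<in> sigma_prod X a. \<forall>k.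
      ((\<lambda>x. \<bar>f x - f (x(k := b k))\<bar>) \<longlongrightarrow> 0) (atin (sigma_top X a) b))"

definition separately_continuous ::
    "(nat \<Rightarrow> 'a topology) \<Rightarrow> (nat \<Rightarrow> 'a) \<Rightarrow> ((nat \<Rightarrow> 'a) \<Rightarrow> real) \<Rightarrow> bool" where
  "separately_continuous X a f \<longleftrightarrow>
    (\<forall>b \<in> sigma_prod X a. \<forall>k.
      topcontinuous_at (X k) euclideanreal (\<lambda>u. f (b(k := u))) (b k))"

text \<open>
  An ordinal \<open>\<alpha>\<close> is represented by an element of a well-ordered type whose set of predecessors
  \<open>{\<beta>. \<beta> < \<alpha>}\<close> has order type \<open>\<alpha>\<close>; the class depends only on that order type, and the least element
  plays the role of \<open>0\<close>. The usual Baire hierarchy is the case of countable sets of predecessors.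
  In \<^typ>\<open>enat\<close>, which has order type \<open>\<omega>\<^sub>0 + 1\<close>, the finite ordinals are the finite elements and
  \<open>\<omega>\<^sub>0\<close> is \<^term>\<open>\<infinity>::enat\<close>.
\<close>
context
  notes conj_cong [fundef_cong]
begin

function baire_class ::
    "'o::wellorder \<Rightarrow> 'z topology \<Rightarrow> 'y topology \<Rightarrow> ('z \<Rightarrow> 'y) set" where
  "baire_class \<alpha> Z Y =
    (if \<forall>\<beta>. \<alpha> \<le> \<beta> then {f. continuous_map Z Y f}
     else {f. \<exists>\<xi> g. (\<forall>n::nat. \<xi> n < \<alpha> \<and> g n \<in> baire_class (\<xi> n) Z Y) \<and>
                    (\<forall>z \<in> topspace Z. limitin Y (\<lambda>n. g n z) (f z) sequentially)})"
  by pat_completeness auto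
termination
  by (relation "inv_image {(\<beta>, \<alpha>). \<beta> < \<alpha>} fst") (auto intro: wf)

end

declare baire_class.simps [simp del]

text \<open>For the least element \<open>\<alpha>\<close> the following set is empty; it is only meant for \<open>\<alpha> \<ge> 1\<close>.\<close>
definition stable_baire_class ::
    "'o::wellorder \<Rightarrow> 'z topology \<Rightarrow> 'y topology \<Rightarrow> ('z \<Rightarrow> 'y) set" where
  "stable_baire_class \<alpha> Z Y =
    {f. \<exists>\<xi> g. (\<forall>n::nat. \<xi> n < \<alpha> \<and> g n \<in> baire_class (\<xi> n) Z Y) \<and>
              (\<forall>z \<in> topspace Z. \<exists>N. \<forall>n\<ge>N. g n z = f z)}"

end

(*
  Let p_n x agree with x below n and with a from n on. On sigma(a) every x is eventually equal
  to p_n x, so f is the stable limit of the functions f o p_n, and it suffices to bound their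
  Baire class. If f is strongly separately continuous, changing the coordinates below n one at a
  time shows that f o p_n is continuous. If f is separately continuous and the factors are
  metrizable, f o p_n has class n by induction (for every base point c in place of a): freezing
  coordinate n at the centres s_i of a locally finite partition of unity of mesh 1/m, f o p_(n+1)
  is the pointwise limit, as m grows, of the sums over i of
  phi_i (x n) * f (p_n x with coordinate n replaced by s_i), each of which has class n.
*)
theory Submission
  imports Defs
begin

section \<open>Baire classes of finite order\<close>

lemma baire_class_least: "\<forall>\<beta>. \<alpha> \<le> \<beta> \<Longrightarrow> baire_class \<alpha> Z Y = {f. continuous_map Z Y f}"
  by (rule trans[OF baire_class.simps if_P])

lemma baire_class_not_least:
  "\<not> (\<forall>\<beta>. \<alpha> \<le> \<beta>) \<Longrightarrow> baire_class \<alpha> Z Y =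
    {f. \<exists>\<xi> g. (\<forall>n::nat. \<xi> n < \<alpha> \<and> g n \<in> baire_class (\<xi> n) Z Y) \<and>
          (\<forall>z \<in> topspace Z. limitin Y (\<lambda>n. g n z) (f z) sequentially)}"
  by (rule trans[OF baire_class.simps if_not_P])

lemma baire_class_enat_0: "baire_class (0::enat) Z Y = {f. continuous_map Z Y f}"
  by (rule baire_class_least) simp

lemma baire_class_limitI:
  assumes "\<And>n::nat. g n \<in> baire_class \<beta> Z Y" "\<beta> < \<alpha>"
    "\<And>z. z \<in> topspace Z \<Longrightarrow> limitin Y (\<lambda>n. g n z) (f z) sequentially"
  shows "f \<in> baire_class \<alpha> Z Y"
proof -
  have "\<not> (\<forall>\<beta>. \<alpha> \<le> \<beta>)"
    using \<open>\<beta> < \<alpha>\<close> by (meson leD)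
  then show ?thesis
    using assms unfolding baire_class_not_least[OF \<open>\<not> (\<forall>\<beta>. \<alpha> \<le> \<beta>)\<close>]
    by (intro CollectI exI[of _ "\<lambda>_. \<beta>"] exI[of _ g]) auto
qed

lemma baire_class_into_topspace:
  assumes "f \<in> baire_class \<alpha> Z Y" "z \<in> topspace Z"
  shows "f z \<in> topspace Y"
proof (cases "\<forall>\<beta>. \<alpha> \<le> \<beta>")
  case True
  then have "continuous_map Z Y f"
    using assms(1) by (simp only: baire_class_least[OF True] mem_Collect_eq)
  then show ?thesis
    using assms(2) by (auto simp: continuous_map_def)
next
  case False
  then obtain g where "\<forall>z \<in> topspace Z. limitin Y (\<lambda>n::nat. g n z) (f z) sequentially"
    using assms(1) unfolding baire_class_not_least[OF False] by blast
  then have "limitin Y (\<lambda>n. g n z) (f z) sequentially"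
    using assms(2) by blast
  then show ?thesis
    by (rule limitin_topspace)
qed

text \<open>A constant sequence witnesses the larger class; for it to converge, its values must lie
  in \<open>topspace Y\<close>, which \<open>baire_class_into_topspace\<close> supplies.\<close>

lemma baire_class_mono:
  assumes "f \<in> baire_class \<alpha> Z Y" "\<alpha> \<le> \<beta>"
  shows "f \<in> baire_class \<beta> Z Y"
proof (cases "\<alpha> = \<beta>")
  case False
  show ?thesis
  proof (rule baire_class_limitI)
    show "f \<in> baire_class \<alpha> Z Y" "\<alpha> < \<beta>"
      using assms False by auto
    show "limitin Y (\<lambda>n. f z) (f z) sequentially" if "z \<in> topspace Z" for z
      using assms(1) that baire_class_into_topspace by simp
  qed
qed (use assms in simp)

lemma baire_class_SucE:
  assumes "f \<in> baire_class (enat (Suc n)) Z Y"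
  obtains g where "\<And>j::nat. g j \<in> baire_class (enat n) Z Y"
    "\<And>z. z \<in> topspace Z \<Longrightarrow> limitin Y (\<lambda>j. g j z) (f z) sequentially"
proof -
  have nl: "\<not> (\<forall>\<beta>. enat (Suc n) \<le> \<beta>)"
    by (auto intro: exI[of _ 0] simp: zero_enat_def)
  obtain \<xi> g where g: "\<And>j::nat. \<xi> j < enat (Suc n) \<and> g j \<in> baire_class (\<xi> j) Z Y"
    "\<And>z. z \<in> topspace Z \<Longrightarrow> limitin Y (\<lambda>n. g n z) (f z) sequentially"
    using assms unfolding baire_class_not_least[OF nl] by blast
  have "\<xi> j \<le> enat n" for j
    using g(1)[of j] by (cases "\<xi> j") auto
  then have "g j \<in> baire_class (enat n) Z Y" for j
    using g(1) baire_class_mono by blast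
  then show ?thesis
    using g(2) that by blast
qed

section \<open>Locally finite sums\<close>

lemma continuous_map_realI:
  assumes "\<And>x e. x \<in> topspace X \<Longrightarrow> e > 0 \<Longrightarrow>
      \<exists>U. openin X U \<and> x \<in> U \<and> (\<forall>y\<in>U. \<bar>f y - f x\<bar> < (e::real))"
  shows "continuous_map X euclideanreal f"
  unfolding continuous_map_atin limitin_canonical_iff tendsto_iff eventually_atin dist_real_def
proof (intro ballI allI impI disjI2)
  fix x and e :: real assume "x \<in> topspace X" "0 < e"
  then obtain U where "openin X U" "x \<in> U" "\<forall>y\<in>U. \<bar>f y - f x\<bar> < e"
    using assms by blast
  then show "\<exists>U. openin X U \<and> x \<in> U \<and> (\<forall>y\<in>U - {x}. \<bar>f y - f x\<bar> < e)"
    by blast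
qed

lemma continuous_map_real_locally:
  fixes f :: "'z \<Rightarrow> real"
  assumes "\<And>x. x \<in> topspace X \<Longrightarrow>
      \<exists>U g. openin X U \<and> x \<in> U \<and> continuous_map X euclideanreal g \<and> (\<forall>y\<in>U. g y = f y)"
  shows "continuous_map X euclideanreal f"
proof (rule continuous_map_realI)
  fix x and e :: real assume "x \<in> topspace X" "0 < e"
  then obtain U g where U: "openin X U" "x \<in> U" "continuous_map X euclideanreal g" "\<And>y. y \<in> U \<Longrightarrow> g y = f y"
    using assms by metis
  let ?V = "{y \<in> topspace X. g y \<in> ball (g x) e}"
  have "openin X ?V"
    by (rule openin_continuous_map_preimage[OF U(3)]) simp
  moreover have "\<bar>f y - f x\<bar> < e" if "y \<in> U \<inter> ?V" for y
    using U(2) that by (simp add: dist_real_def abs_minus_commute flip: U(4))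
  ultimately show "\<exists>U. openin X U \<and> x \<in> U \<and> (\<forall>y\<in>U. \<bar>f y - f x\<bar> < e)"
    using U(1,2) \<open>x \<in> topspace X\<close> \<open>0 < e\<close> by (intro exI[of _ "U \<inter> ?V"]) auto
qed

definition locally_finite_family :: "'z topology \<Rightarrow> ('i \<Rightarrow> 'z \<Rightarrow> real) \<Rightarrow> bool" where
  "locally_finite_family Z \<phi> \<longleftrightarrow>
    (\<forall>x\<in>topspace Z. \<exists>U. openin Z U \<and> x \<in> U \<and> finite {i. \<exists>y\<in>U. \<phi> i y \<noteq> 0})"

text \<open>Summing over the support at \<open>x\<close> makes a sum over an arbitrary index type
  finite at each point of a locally finite family, and ignores \<open>h i\<close> wherever
  \<open>\<phi> i\<close> vanishes.\<close>

definition support_sum :: "('i \<Rightarrow> 'z \<Rightarrow> real) \<Rightarrow> ('i \<Rightarrow> 'z \<Rightarrow> real) \<Rightarrow> 'z \<Rightarrow> real" where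
  "support_sum \<phi> h x = (\<Sum>i | \<phi> i x \<noteq> 0. \<phi> i x * h i x)"

lemma locally_finite_family_finite:
  assumes "locally_finite_family Z \<phi>" "x \<in> topspace Z"
  shows "finite {i. \<phi> i x \<noteq> 0}"
proof -
  obtain U where "x \<in> U" "finite {i. \<exists>y\<in>U. \<phi> i y \<noteq> 0}"
    using assms unfolding locally_finite_family_def by blast
  moreover have "{i. \<phi> i x \<noteq> 0} \<subseteq> {i. \<exists>y\<in>U. \<phi> i y \<noteq> 0}"
    using \<open>x \<in> U\<close> by blast
  ultimately show ?thesis
    using finite_subset by blast
qed

text \<open>Near each point only finitely many indices occur, and there the sum agrees with a finite
  sum of continuous products.\<close>

lemma continuous_map_support_sum:
  assumes "locally_finite_family Z \<phi>" "\<And>i. continuous_map Z euclideanreal (\<phi> i)"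
    and "\<And>i x. x \<in> topspace Z \<Longrightarrow> \<phi> i x \<noteq> 0 \<Longrightarrow> continuous_map Z euclideanreal (h i)"
  shows "continuous_map Z euclideanreal (support_sum \<phi> h)"
proof (rule continuous_map_real_locally)
  fix x assume "x \<in> topspace Z"
  then obtain U where U: "openin Z U" "x \<in> U" and fin: "finite {i. \<exists>y\<in>U. \<phi> i y \<noteq> 0}" (is "finite ?I")
    using assms(1) unfolding locally_finite_family_def by blast
  have "continuous_map Z euclideanreal (\<lambda>y. \<Sum>i\<in>?I. \<phi> i y * h i y)"
  proof (intro continuous_map_sum fin continuous_map_real_mult assms(2))
    fix i assume "i \<in> ?I"
    then obtain y where "y \<in> U" "\<phi> i y \<noteq> 0"
      by blast
    then show "continuous_map Z euclideanreal (h i)"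
      using assms(3) openin_subset[OF U(1)] by blast
  qed
  moreover have "(\<Sum>i\<in>?I. \<phi> i y * h i y) = support_sum \<phi> h y" if "y \<in> U" for y
    unfolding support_sum_def using that by (intro sum.mono_neutral_right fin) auto
  ultimately show "\<exists>U g. openin Z U \<and> x \<in> U \<and> continuous_map Z euclideanreal g \<and>
      (\<forall>y\<in>U. g y = support_sum \<phi> h y)"
    using U by blast
qed

text \<open>Induction on \<open>n\<close>: all the \<open>h i\<close> are approximated at once, and
  the limit passes through the sum because its index set at a fixed point does not depend on the
  approximation. The condition on \<open>h i\<close> concerns only indices whose
  \<open>\<phi> i\<close> is somewhere nonzero, because in the application other indices may carry a
  centre outside the space.\<close>

lemma baire_class_support_sum:
  assumes "locally_finite_family Z \<phi>" "\<And>i. continuous_map Z euclideanreal (\<phi> i)"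
    and "\<And>i x. x \<in> topspace Z \<Longrightarrow> \<phi> i x \<noteq> 0 \<Longrightarrow> h i \<in> baire_class (enat n) Z euclideanreal"
  shows "support_sum \<phi> h \<in> baire_class (enat n) Z euclideanreal"
  using assms(3)
proof (induction n arbitrary: h)
  case 0
  then show ?case
    using continuous_map_support_sum[OF assms(1,2), of h]
    by (simp add: baire_class_enat_0 flip: zero_enat_def)
next
  case (Suc n)
  have "\<exists>g. (\<exists>x\<in>topspace Z. \<phi> i x \<noteq> 0) \<longrightarrow>
      (\<forall>j::nat. g j \<in> baire_class (enat n) Z euclideanreal) \<and>
      (\<forall>z\<in>topspace Z. (\<lambda>j. g j z) \<longlonglongrightarrow> h i z)" for i
  proof (cases "\<exists>x\<in>topspace Z. \<phi> i x \<noteq> 0")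
    case True
    then have "h i \<in> baire_class (enat (Suc n)) Z euclideanreal"
      using Suc.prems by blast
    then obtain g where "\<And>j::nat. g j \<in> baire_class (enat n) Z euclideanreal"
      "\<And>z. z \<in> topspace Z \<Longrightarrow> limitin euclideanreal (\<lambda>j. g j z) (h i z) sequentially"
      by (rule baire_class_SucE) blast
    then show ?thesis
      by (intro exI[of _ g]) simp
  qed auto
  then obtain g where g: "\<And>i. (\<exists>x\<in>topspace Z. \<phi> i x \<noteq> 0) \<Longrightarrow>
      (\<forall>j::nat. g i j \<in> baire_class (enat n) Z euclideanreal) \<and>
      (\<forall>z\<in>topspace Z. (\<lambda>j. g i j z) \<longlonglongrightarrow> h i z)"
    by metis
  show ?case
  proof (rule baire_class_limitI)
    show "support_sum \<phi> (\<lambda>i. g i j) \<in> baire_class (enat n) Z euclideanreal" for j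
      using g by (intro Suc.IH) blast
    show "limitin euclideanreal (\<lambda>j. support_sum \<phi> (\<lambda>i. g i j) z) (support_sum \<phi> h z) sequentially"
      if "z \<in> topspace Z" for z
      unfolding support_sum_def limitin_canonical_iff
      using g that by (intro tendsto_sum tendsto_mult tendsto_const) blast
  qed simp
qed

text \<open>Each function is divided by the sum \<open>S\<close>, which is continuous by local
  finiteness and positive on the space. Off the space \<open>S\<close> may be 0; division by 0
  yields 0 and keeps the quotients nonnegative.\<close>

lemma locally_finite_normalize:
  assumes lf: "locally_finite_family Z \<phi>" and cont: "\<And>i. continuous_map Z euclideanreal (\<phi> i)"
    and nonneg: "\<And>i x. 0 \<le> \<phi> i x" and pos: "\<And>x. x \<in> topspace Z \<Longrightarrow> \<exists>i. 0 < \<phi> i x"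
  obtains \<theta> where "locally_finite_family Z \<theta>" "\<And>i. continuous_map Z euclideanreal (\<theta> i)"
    "\<And>i x. 0 \<le> \<theta> i x" "\<And>i x. \<theta> i x \<noteq> 0 \<Longrightarrow> \<phi> i x \<noteq> 0"
    "\<And>x. x \<in> topspace Z \<Longrightarrow> (\<Sum>i | \<theta> i x \<noteq> 0. \<theta> i x) = 1"
proof -
  define S where "S = support_sum \<phi> (\<lambda>_ _. 1)"
  have S: "S x = (\<Sum>i | \<phi> i x \<noteq> 0. \<phi> i x)" for x
    by (simp add: S_def support_sum_def)
  have S_nonneg: "0 \<le> S x" for x
    unfolding S by (intro sum_nonneg nonneg)
  have S_pos: "0 < S x" if x: "x \<in> topspace Z" for x
  proof -
    obtain i where "0 < \<phi> i x"
      using pos[OF x] by blast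
    then show ?thesis
      unfolding S using locally_finite_family_finite[OF lf x] nonneg by (intro sum_pos2[of _ i]) auto
  qed
  have S_cont: "continuous_map Z euclideanreal S"
    unfolding S_def by (rule continuous_map_support_sum[OF lf cont]) simp
  show ?thesis
  proof
    show "locally_finite_family Z (\<lambda>i x. \<phi> i x / S x)"
      unfolding locally_finite_family_def
    proof
      fix x assume "x \<in> topspace Z"
      then obtain U where "openin Z U" "x \<in> U" "finite {i. \<exists>y\<in>U. \<phi> i y \<noteq> 0}"
        using lf unfolding locally_finite_family_def by blast
      moreover have "{i. \<exists>y\<in>U. \<phi> i y / S y \<noteq> 0} \<subseteq> {i. \<exists>y\<in>U. \<phi> i y \<noteq> 0}"
        by auto
      ultimately show "\<exists>U. openin Z U \<and> x \<in> U \<and> finite {i. \<exists>y\<in>U. \<phi> i y / S y \<noteq> 0}"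
        using finite_subset by blast
    qed
    show "continuous_map Z euclideanreal (\<lambda>x. \<phi> i x / S x)" for i
      using S_pos by (intro continuous_map_real_divide cont S_cont) fastforce
    show "(\<Sum>i | \<phi> i x / S x \<noteq> 0. \<phi> i x / S x) = 1" if "x \<in> topspace Z" for x
      using S_pos[OF that] by (simp add: S flip: sum_divide_distrib)
  qed (use nonneg S_nonneg in auto)
qed

section \<open>Fine partitions of unity on metric spaces\<close>

context Metric_space
begin

text \<open>This is the maximum of 0 and \<open>r\<close> minus the distance from \<open>x\<close>
  to \<open>A\<close>; inserting 0 also gives the value 0 for empty \<open>A\<close>.\<close>

definition bump :: "'a set \<Rightarrow> real \<Rightarrow> 'a \<Rightarrow> real" where
  "bump A r x = Sup (insert 0 ((\<lambda>y. r - d x y) ` A))"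

lemma bump_bdd: "bdd_above (insert 0 ((\<lambda>y. r - d x y) ` A))"
proof (rule bdd_aboveI)
  fix t assume "t \<in> insert 0 ((\<lambda>y. r - d x y) ` A)"
  then consider "t = 0" | y where "t = r - d x y"
    by blast
  then show "t \<le> \<bar>r\<bar>"
    by cases (use abs_ge_self[of r] nonneg[of x] in \<open>simp, metis add_increasing2 diff_le_eq\<close>)
qed

lemma bump_nonneg: "0 \<le> bump A r x"
  unfolding bump_def by (intro cSup_upper bump_bdd) simp

lemma bump_ge: "y \<in> A \<Longrightarrow> r - d x y \<le> bump A r x"
  unfolding bump_def by (intro cSup_upper bump_bdd) simp

lemma bump_le: "0 \<le> r \<Longrightarrow> bump A r x \<le> r"
  unfolding bump_def by (intro cSup_least) auto

lemma bump_posE: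
  assumes "0 < bump A r x"
  obtains y where "y \<in> A" "d x y < r"
proof -
  have "\<exists>t\<in>insert 0 ((\<lambda>y. r - d x y) ` A). 0 < t"
    using assms unfolding bump_def by (subst (asm) less_cSup_iff[OF _ bump_bdd]) auto
  then show ?thesis
    using that by auto
qed

lemma bump_lipschitz:
  assumes "A \<subseteq> M" "x \<in> M" "y \<in> M"
  shows "bump A r x \<le> bump A r y + d x y"
  unfolding bump_def[of A r x]
proof (rule cSup_least)
  fix t assume "t \<in> insert 0 ((\<lambda>z. r - d x z) ` A)"
  then consider "t = 0" | z where "z \<in> A" "t = r - d x z"
    by blast
  then show "t \<le> bump A r y + d x y"
  proof cases
    case 1
    then show ?thesis
      using bump_nonneg[of A r y] by simp
  next
    case 2
    then have "d y z \<le> d y x + d x z"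
      using assms by (intro triangle) auto
    then show ?thesis
      using 2 bump_ge[of z A r y] by (simp add: commute)
  qed
qed simp

lemma continuous_map_bump:
  assumes "A \<subseteq> M"
  shows "continuous_map mtopology euclideanreal (bump A r)"
proof (rule continuous_map_realI)
  fix x and e :: real assume x: "x \<in> topspace mtopology" and "0 < e"
  have "\<bar>bump A r y - bump A r x\<bar> < e" if "y \<in> mball x e" for y
    using that bump_lipschitz[OF assms, of x y r] bump_lipschitz[OF assms, of y x r]
    by (auto simp: commute)
  then show "\<exists>U. openin mtopology U \<and> x \<in> U \<and> (\<forall>y\<in>U. \<bar>bump A r y - bump A r x\<bar> < e)"
    using x \<open>0 < e\<close> by (intro exI[of _ "mball x e"]) auto
qed

text \<open>With \<open>M\<close> well-ordered, \<open>p x\<close> is the least point of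
  \<open>M\<close> within \<open>e\<close> of \<open>x\<close>. If \<open>p x\<close> precedes
  \<open>p y\<close>, then \<open>p x\<close> is at distance at least \<open>e\<close> from
  \<open>y\<close>, since otherwise \<open>p y\<close> would not be least for \<open>y\<close>; the
  other case is symmetric.\<close>

lemma first_center:
  assumes "0 < e"
  obtains p where "\<And>x. x \<in> M \<Longrightarrow> p x \<in> M" "\<And>x. x \<in> M \<Longrightarrow> d x (p x) < e"
    "\<And>x y. x \<in> M \<Longrightarrow> y \<in> M \<Longrightarrow> p x \<noteq> p y \<Longrightarrow> e \<le> d y (p x) \<or> e \<le> d x (p y)"
proof -
  obtain r where r: "well_order_on M r"
    using well_order_on by blast
  then have wf: "wf (r - Id)" and tot: "total_on M r"
    by (auto simp: well_order_on_def linear_order_on_def)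
  have "\<exists>s. s \<in> M \<and> d x s < e \<and> (\<forall>t. (t, s) \<in> r - Id \<longrightarrow> \<not> (t \<in> M \<and> d x t < e))" if "x \<in> M" for x
    using wfE_min[OF wf, of x "{s \<in> M. d x s < e}"] that assms by auto
  then obtain p where p: "\<And>x. x \<in> M \<Longrightarrow> p x \<in> M" "\<And>x. x \<in> M \<Longrightarrow> d x (p x) < e"
    "\<And>x t. x \<in> M \<Longrightarrow> (t, p x) \<in> r - Id \<Longrightarrow> \<not> (t \<in> M \<and> d x t < e)"
    by metis
  have "e \<le> d y (p x) \<or> e \<le> d x (p y)" if "x \<in> M" "y \<in> M" "p x \<noteq> p y" for x y
  proof -
    have "(p x, p y) \<in> r - Id \<or> (p y, p x) \<in> r - Id"
      using tot that p(1) by (auto simp: total_on_def)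
    then show ?thesis
      using p(1,3) that by (meson not_le)
  qed
  then show ?thesis
    using p that by blast
qed

text \<open>
  Stone's construction: points are grouped by the first centre \<open>p x\<close> whose \<open>e\<close>-ball contains them,
  and the points \<open>x\<close> of depth at least \<open>3 / (n + 1)\<close> in that ball form a family of sets which is
  uniformly discrete for fixed \<open>n\<close>. Subtracting \<open>n\<close> times the bumps of the earlier levels makes the
  resulting countable union of discrete families locally finite.
\<close>
lemma locally_finite_fine_family:
  assumes "0 < e"
  obtains \<phi> :: "nat \<times> 'a \<Rightarrow> 'a \<Rightarrow> real"
  where "locally_finite_family mtopology \<phi>" "\<And>i. continuous_map mtopology euclideanreal (\<phi> i)"
    "\<And>i x. 0 \<le> \<phi> i x" "\<And>x. x \<in> M \<Longrightarrow> \<exists>i. 0 < \<phi> i x"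
    "\<And>i x. x \<in> M \<Longrightarrow> \<phi> i x \<noteq> 0 \<Longrightarrow> snd i \<in> M \<and> d x (snd i) < e"
proof -
  obtain p where p: "\<And>x. x \<in> M \<Longrightarrow> p x \<in> M" "\<And>x. x \<in> M \<Longrightarrow> d x (p x) < e"
    "\<And>x y. x \<in> M \<Longrightarrow> y \<in> M \<Longrightarrow> p x \<noteq> p y \<Longrightarrow> e \<le> d y (p x) \<or> e \<le> d x (p y)"
    using first_center[OF assms] by metis
  define \<delta> where "\<delta> n = 1 / real (Suc n)" for n
  \<comment> \<open>With depth \<open>3 * \<delta> n\<close>, points grouped under different centres
    are at least that far apart, so bumps of radius \<open>\<delta> n\<close> around the groups
    still leave a gap of \<open>\<delta> n\<close> between their supports.\<close>
  define T where "T n = {x \<in> M. d x (p x) + 3 * \<delta> n \<le> e}" for n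
  define S where "S n s = {x \<in> T n. p x = s}" for n s
  define \<Psi> where "\<Psi> n = bump (T n) (\<delta> n)" for n
  \<comment> \<open>The factor \<open>fst i\<close> is the level. It is unbounded, so a fixed
    positive lower bound on one earlier bump eventually outweighs the later bumps, all of which are
    at most 1.\<close>
  define \<phi> where "\<phi> i x = max 0 (bump (S (fst i) (snd i)) (\<delta> (fst i)) x - real (fst i) * (\<Sum>k<fst i. \<Psi> k x))"
    for i :: "nat \<times> 'a" and x
  have \<delta>_pos: "0 < \<delta> n" for n
    by (simp add: \<delta>_def)
  have \<delta>_mono: "\<delta> n \<le> \<delta> m" if "m \<le> n" for m n
    using that by (simp add: \<delta>_def divide_simps)
  have TM: "T n \<subseteq> M" and SM: "S n s \<subseteq> M" for n s
    by (auto simp: T_def S_def)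
  have \<Psi>_nonneg: "0 \<le> \<Psi> n x" for n x
    by (simp add: \<Psi>_def bump_nonneg)
  have supp: "0 < bump (S n s) (\<delta> n) x" if "\<phi> (n, s) x \<noteq> 0" for n s x
  proof -
    have "0 \<le> real n * (\<Sum>k<n. \<Psi> k x)"
      by (intro mult_nonneg_nonneg sum_nonneg \<Psi>_nonneg) simp
    then show ?thesis
      using that by (auto simp: \<phi>_def max_def split: if_splits)
  qed
  have separated: "s = t" if "x \<in> S n s" "y \<in> S n t" "d x y < 3 * \<delta> n" for x y n s t
  proof (rule ccontr)
    assume "s \<noteq> t"
    with that have xy: "x \<in> M" "y \<in> M" "p x = s" "p y = t" "d x s + 3 * \<delta> n \<le> e" "d y t + 3 * \<delta> n \<le> e"
      by (auto simp: S_def T_def)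
    then have "d y s \<le> d y x + d x s" "d x t \<le> d x y + d y t"
      using p(1) by (auto intro!: triangle)
    then show False
      using p(3)[of x y] \<open>s \<noteq> t\<close> xy that(3) by (auto simp: commute)
  qed
  have deep: "\<exists>k. x \<in> T k" if "x \<in> M" for x
  proof -
    have "0 < (e - d x (p x)) / 3"
      using p(2)[OF that] by simp
    then obtain k where "inverse (real (Suc k)) < (e - d x (p x)) / 3"
      using reals_Archimedean by blast
    then have "d x (p x) + 3 * \<delta> k \<le> e"
      by (simp add: \<delta>_def inverse_eq_divide)
    then show ?thesis
      using that by (auto simp: T_def)
  qed
  show ?thesis
  proof
    show "0 \<le> \<phi> i x" for i x
      by (simp add: \<phi>_def)
    show "continuous_map mtopology euclideanreal (\<phi> i)" for i
      unfolding \<phi>_def \<Psi>_def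
      by (intro continuous_intros continuous_map_bump TM SM finite_lessThan) auto
    show "\<exists>i. 0 < \<phi> i x" if x: "x \<in> M" for x
    proof -
      obtain k where "x \<in> T k"
        using deep[OF x] by blast
      then have "0 < \<Psi> k x"
        using bump_ge[of x "T k" "\<delta> k" x] \<delta>_pos[of k] x by (simp add: \<Psi>_def)
      \<comment> \<open>At the first level whose bump \<open>\<Psi> n\<close> is positive at
        \<open>x\<close>, nothing is subtracted.\<close>
      then obtain n where n: "0 < \<Psi> n x" "\<And>k. k < n \<Longrightarrow> \<not> 0 < \<Psi> k x"
        using exists_least_iff[of "\<lambda>k. 0 < \<Psi> k x"] by blast
      obtain y where y: "y \<in> T n" "d x y < \<delta> n"
        using n(1) unfolding \<Psi>_def by (rule bump_posE)
      have "(\<Sum>k<n. \<Psi> k x) = 0"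
        using n(2) \<Psi>_nonneg by (intro sum.neutral) (force simp: not_less intro: antisym)
      moreover have "0 < bump (S n (p y)) (\<delta> n) x"
        using bump_ge[of y "S n (p y)" "\<delta> n" x] y by (simp add: S_def)
      ultimately have "0 < \<phi> (n, p y) x"
        by (simp add: \<phi>_def)
      then show ?thesis
        by blast
    qed
    show "snd i \<in> M \<and> d x (snd i) < e" if x: "x \<in> M" and "\<phi> i x \<noteq> 0" for i x
    proof -
      obtain n s where i: "i = (n, s)"
        by (cases i)
      obtain y where y: "y \<in> S n s" "d x y < \<delta> n"
        using supp \<open>\<phi> i x \<noteq> 0\<close> unfolding i by (metis bump_posE)
      then have "y \<in> M" "p y = s" "d y s + 3 * \<delta> n \<le> e"
        by (auto simp: S_def T_def)
      moreover have "d x s \<le> d x y + d y s"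
        using calculation x p(1) by (intro triangle) auto
      ultimately show ?thesis
        using y \<delta>_pos[of n] p(1) i by auto
    qed
    show "locally_finite_family mtopology \<phi>"
      unfolding locally_finite_family_def
    proof
      fix x assume "x \<in> topspace mtopology"
      then have x: "x \<in> M"
        by simp
      obtain k where k: "x \<in> T k"
        using deep[OF x] by blast
      \<comment> \<open>On the ball \<open>U\<close> of radius \<open>\<delta> N / 2\<close>,
        \<open>\<Psi> k\<close> stays at least \<open>\<delta> k / 2\<close>. This \<open>m\<close>
        makes \<open>real m * (\<delta> k / 2)\<close> exceed 1, the bound on every bump, so levels
        from \<open>N\<close> on vanish on \<open>U\<close>; \<open>k < N\<close> puts
        \<open>\<Psi> k\<close> among the bumps subtracted there.\<close>
      obtain m where m: "2 / \<delta> k < real m"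
        using reals_Archimedean2 by blast
      define N where "N = max (Suc k) m"
      define U where "U = mball x (\<delta> N / 2)"
      have vanish: "n < N" if "y \<in> U" "\<phi> (n, s) y \<noteq> 0" for n s y
      proof (rule ccontr)
        assume "\<not> n < N"
        then have "k < n" "m \<le> n"
          by (auto simp: N_def)
        have "\<delta> N \<le> \<delta> k"
          by (intro \<delta>_mono) (simp add: N_def)
        have "\<Psi> k x = \<delta> k" if "x \<in> M"
          using bump_ge[OF k, of "\<delta> k" x] bump_le[of "\<delta> k" "T k" x] \<delta>_pos[of k] that
          by (simp add: \<Psi>_def)
        moreover have "\<Psi> k x \<le> \<Psi> k y + d x y"
          unfolding \<Psi>_def using \<open>y \<in> U\<close> x by (intro bump_lipschitz TM) (auto simp: U_def)
        moreover have "d x y < \<delta> k / 2"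
          using \<open>y \<in> U\<close> \<open>\<delta> N \<le> \<delta> k\<close> by (simp add: U_def)
        ultimately have "\<delta> k / 2 \<le> \<Psi> k y"
          using x by simp
        also have "\<dots> \<le> (\<Sum>k<n. \<Psi> k y)"
          using \<open>k < n\<close> \<Psi>_nonneg by (intro member_le_sum) auto
        finally have "\<delta> k / 2 \<le> (\<Sum>k<n. \<Psi> k y)" .
        then have "real m * (\<delta> k / 2) \<le> real n * (\<Sum>k<n. \<Psi> k y)"
          using \<open>m \<le> n\<close> \<delta>_pos[of k] by (intro mult_mono) auto
        moreover have "1 \<le> real m * (\<delta> k / 2)"
          using m \<delta>_pos[of k] by (simp add: field_simps)
        moreover have "\<delta> 0 = 1"
          by (simp add: \<delta>_def)
        then have "bump (S n s) (\<delta> n) y \<le> 1"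
          using bump_le[of "\<delta> n" "S n s" y] \<delta>_pos[of n] \<delta>_mono[of 0 n] \<open>\<delta> 0 = 1\<close> by simp
        ultimately have "\<phi> (n, s) y = 0"
          by (simp add: \<phi>_def)
        then show False
          using that by simp
      qed
      \<comment> \<open>For \<open>n < N\<close>, points of \<open>U\<close> are less than
        \<open>\<delta> n\<close> apart; adding the two bump radii keeps \<open>y'\<close> and
        \<open>z'\<close> closer than \<open>3 * \<delta> n\<close>, too close for different
        centres.\<close>
      have unique: "s = t"
        if yz: "y \<in> U" "z \<in> U" "\<phi> (n, s) y \<noteq> 0" "\<phi> (n, t) z \<noteq> 0" for n s t y z
      proof -
        obtain y' where y': "y' \<in> S n s" "d y y' < \<delta> n"
          using supp[OF yz(3)] by (rule bump_posE)
        obtain z' where z': "z' \<in> S n t" "d z z' < \<delta> n"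
          using supp[OF yz(4)] by (rule bump_posE)
        have M: "y' \<in> M" "z' \<in> M" "y \<in> M" "z \<in> M"
          using y' z' SM that by (auto simp: U_def)
        have "d x y < \<delta> n / 2" "d x z < \<delta> n / 2"
          using that(1,2) vanish[OF that(1,3)] \<delta>_mono[of n N] by (auto simp: U_def)
        moreover have "d y' z' \<le> d y' y + d y z'" "d y z' \<le> d y z + d z z'" "d y z \<le> d y x + d x z"
          using M x by (auto intro!: triangle)
        ultimately have "d y' z' < 3 * \<delta> n"
          using y' z' by (simp add: commute)
        then show ?thesis
          using separated y' z' by blast
      qed
      let ?I = "{i. \<exists>y\<in>U. \<phi> i y \<noteq> 0}"
      \<comment> \<open>Each level contributes at most one index, and only levels below
        \<open>N\<close> occur.\<close>
      have "inj_on fst ?I"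
        using unique by (auto simp: inj_on_def)
      moreover have "fst ` ?I \<subseteq> {..<N}"
        using vanish by auto
      ultimately have "finite ?I"
        by (meson finite_lessThan inj_on_finite)
      moreover have "openin mtopology U" "x \<in> U"
        using x \<delta>_pos[of N] by (auto simp: U_def)
      ultimately show "\<exists>U. openin mtopology U \<and> x \<in> U \<and> finite {i. \<exists>y\<in>U. \<phi> i y \<noteq> 0}"
        by blast
    qed
  qed
qed

end

section \<open>Functions of finitely many coordinates\<close>

text \<open>The map p_n with its base point \<open>c\<close> as an argument, since the induction for
  separately continuous functions varies it. With the roles exchanged,
  \<open>splice_at n x c\<close> overwrites the first \<open>n\<close> coordinates of
  \<open>x\<close> by those of \<open>c\<close>.\<close>

definition splice_at :: "nat \<Rightarrow> (nat \<Rightarrow> 'a) \<Rightarrow> (nat \<Rightarrow> 'a) \<Rightarrow> nat \<Rightarrow> 'a" where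
  "splice_at n c x = (\<lambda>k. if k < n then x k else c k)"

lemma splice_at_0 [simp]: "splice_at 0 c x = c"
  by (simp add: splice_at_def)

lemma splice_at_Suc: "splice_at (Suc n) c x = (splice_at n c x)(n := x n)"
  by (auto simp: splice_at_def)

lemma topspace_sigma_top [simp]: "topspace (sigma_top X a) = sigma_prod X a"
  by (auto simp: sigma_top_def sigma_prod_def)

lemma splice_in_sigma_prod:
  assumes "c \<in> sigma_prod X a" "x \<in> sigma_prod X a"
  shows "splice_at n c x \<in> sigma_prod X a"
proof -
  have "{k. splice_at n c x k \<noteq> a k} \<subseteq> {k. x k \<noteq> a k} \<union> {k. c k \<noteq> a k}"
    by (auto simp: splice_at_def)
  then have "finite {k. splice_at n c x k \<noteq> a k}"
    by (rule finite_subset) (use assms in \<open>simp add: sigma_prod_def\<close>)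
  moreover have "splice_at n c x \<in> topspace (product_topology X UNIV)"
    using assms by (auto simp: sigma_prod_def splice_at_def PiE_iff)
  ultimately show ?thesis
    by (simp add: sigma_prod_def)
qed

lemma fun_upd_in_sigma_prod:
  assumes "c \<in> sigma_prod X a" "u \<in> topspace (X n)"
  shows "c(n := u) \<in> sigma_prod X a"
proof -
  have "{k. (c(n := u)) k \<noteq> a k} \<subseteq> insert n {k. c k \<noteq> a k}"
    by auto
  then have "finite {k. (c(n := u)) k \<noteq> a k}"
    by (rule finite_subset) (use assms in \<open>simp add: sigma_prod_def\<close>)
  then show ?thesis
    using assms by (auto simp: sigma_prod_def PiE_iff)
qed

text \<open>Any strict bound on the finite set of coordinates where \<open>x\<close> differs from
  \<open>a\<close> serves as \<open>N\<close>; this makes the limit stable in both parts of the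
  theorem.\<close>

lemma splice_eventually_id:
  assumes "x \<in> sigma_prod X a"
  shows "\<exists>N. \<forall>n\<ge>N. splice_at n a x = x"
proof -
  have "finite {k. x k \<noteq> a k}"
    using assms by (simp add: sigma_prod_def)
  then obtain N where N: "\<And>k. x k \<noteq> a k \<Longrightarrow> k < N"
    unfolding finite_nat_set_iff_bounded by blast
  have "splice_at n a x = x" if "N \<le> n" for n
  proof
    show "splice_at n a x k = x k" for k
      using N[of k] that by (cases "x k = a k") (auto simp: splice_at_def)
  qed
  then show ?thesis
    by blast
qed

lemma continuous_map_sigma_proj: "continuous_map (sigma_top X a) (X k) (\<lambda>x. x k)"
  unfolding sigma_top_def
  by (intro continuous_map_from_subtopology continuous_map_product_projection) simp

lemma continuous_map_into_sigma_top:
  assumes "continuous_map Z (product_topology X UNIV) g"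
    and "\<And>z. z \<in> topspace Z \<Longrightarrow> g z \<in> sigma_prod X a"
  shows "continuous_map Z (sigma_top X a) g"
  unfolding sigma_top_def using assms by (intro continuous_map_into_subtopology) auto

lemma continuous_map_splice:
  assumes "c \<in> sigma_prod X a"
  shows "continuous_map (sigma_top X a) (sigma_top X a) (splice_at n c)"
    and "continuous_map (sigma_top X a) (sigma_top X a) (\<lambda>x. splice_at n x c)"
proof -
  have c: "c k \<in> topspace (X k)" for k
    using assms by (auto simp: sigma_prod_def PiE_iff)
  have "continuous_map (sigma_top X a) (product_topology X UNIV) (splice_at n c)"
    "continuous_map (sigma_top X a) (product_topology X UNIV) (\<lambda>x. splice_at n x c)"
    unfolding continuous_map_componentwise_UNIV splice_at_def
    using c continuous_map_sigma_proj[of X a] by (auto simp: continuous_map_const)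
  then show "continuous_map (sigma_top X a) (sigma_top X a) (splice_at n c)"
    "continuous_map (sigma_top X a) (sigma_top X a) (\<lambda>x. splice_at n x c)"
    by (auto intro!: continuous_map_into_sigma_top splice_in_sigma_prod assms)
qed

section \<open>Strongly separately continuous functions\<close>

text \<open>The first \<open>n\<close> coordinates of \<open>x\<close> are changed to those of
  \<open>c\<close> one at a time. Each change is made at a partly changed point, which tends to
  \<open>c\<close> as \<open>x\<close> does, so strong separate continuity at the one point
  \<open>c\<close> bounds its effect.\<close>

lemma strongly_separately_continuous_splice_close:
  assumes f: "strongly_separately_continuous X a f" and c: "c \<in> sigma_prod X a" and "0 < e"
  shows "\<exists>U. openin (sigma_top X a) U \<and> c \<in> U \<and> (\<forall>x\<in>U. \<bar>f x - f (splice_at n x c)\<bar> < e)"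
  using \<open>0 < e\<close>
proof (induction n arbitrary: e)
  case 0
  then show ?case
    using c openin_topspace[of "sigma_top X a"] by (intro exI[of _ "sigma_prod X a"]) simp
next
  case (Suc n)
  obtain U where U: "openin (sigma_top X a) U" "c \<in> U" "\<And>x. x \<in> U \<Longrightarrow> \<bar>f x - f (splice_at n x c)\<bar> < e / 2"
    using Suc.IH[of "e / 2"] Suc.prems by auto
  have "((\<lambda>x. \<bar>f x - f (x(n := c n))\<bar>) \<longlongrightarrow> 0) (atin (sigma_top X a) c)"
    using f c by (simp add: strongly_separately_continuous_def)
  then have "eventually (\<lambda>x. \<bar>f x - f (x(n := c n))\<bar> < e / 2) (atin (sigma_top X a) c)"
    using Suc.prems by (auto dest!: order_tendstoD(2)[of _ _ _ "e / 2"])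
  then obtain V where V: "openin (sigma_top X a) V" "c \<in> V"
      "\<And>x. x \<in> V - {c} \<Longrightarrow> \<bar>f x - f (x(n := c n))\<bar> < e / 2"
    using c unfolding eventually_atin by auto
  \<comment> \<open>The filter is punctured at \<open>c\<close>, but at \<open>x = c\<close> the
    difference is 0.\<close>
  have V': "\<bar>f x - f (x(n := c n))\<bar> < e / 2" if "x \<in> V" for x
    using V(3)[of x] that Suc.prems by (cases "x = c") auto
  let ?W = "{x \<in> topspace (sigma_top X a). splice_at n x c \<in> V}"
  have "splice_at n c c = c"
    by (simp add: splice_at_def)
  moreover have "openin (sigma_top X a) ?W"
    using continuous_map_splice(2)[OF c] V(1) by (rule openin_continuous_map_preimage)
  moreover have "\<bar>f x - f (splice_at (Suc n) x c)\<bar> < e" if "x \<in> U \<inter> ?W" for x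
  proof -
    have "\<bar>f x - f (splice_at n x c)\<bar> < e / 2"
      using U(3) that by simp
    moreover have "\<bar>f (splice_at n x c) - f (splice_at (Suc n) x c)\<bar> < e / 2"
      using V' that unfolding splice_at_Suc by simp
    ultimately show ?thesis
      by linarith
  qed
  ultimately show ?case
    using U V c by (intro exI[of _ "U \<inter> ?W"]) auto
qed

text \<open>The preceding estimate is applied at the truncation of \<open>b\<close>. The truncation
  of any \<open>x\<close> becomes that very point once its first \<open>n\<close> coordinates are
  overwritten by those of \<open>b\<close>, so the estimate compares the two values
  directly.\<close>

lemma strongly_separately_continuous_splice:
  assumes f: "strongly_separately_continuous X a f" and a: "a \<in> sigma_prod X a"
  shows "continuous_map (sigma_top X a) euclideanreal (\<lambda>x. f (splice_at n a x))"
proof (rule continuous_map_realI)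
  fix b and e :: real assume b: "b \<in> topspace (sigma_top X a)" and "0 < e"
  let ?c = "splice_at n a b"
  have "?c \<in> sigma_prod X a"
    using a b by (simp add: splice_in_sigma_prod)
  then obtain U where U: "openin (sigma_top X a) U" "?c \<in> U" "\<And>x. x \<in> U \<Longrightarrow> \<bar>f x - f (splice_at n x ?c)\<bar> < e"
    using strongly_separately_continuous_splice_close[OF f _ \<open>0 < e\<close>] by metis
  let ?V = "{x \<in> topspace (sigma_top X a). splice_at n a x \<in> U}"
  have "openin (sigma_top X a) ?V"
    using continuous_map_splice(1)[OF a] U(1) by (rule openin_continuous_map_preimage)
  moreover have "splice_at n (splice_at n a x) ?c = ?c" for x
    by (auto simp: splice_at_def)
  then have "\<bar>f (splice_at n a x) - f ?c\<bar> < e" if "x \<in> ?V" for x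
    using U(3)[of "splice_at n a x"] that by simp
  ultimately show "\<exists>U. openin (sigma_top X a) U \<and> b \<in> U \<and> (\<forall>x\<in>U. \<bar>f (splice_at n a x) - f ?c\<bar> < e)"
    using U(2) b by (intro exI[of _ ?V]) auto
qed

section \<open>Separately continuous functions over metrizable factors\<close>

text \<open>On the space, members of \<open>\<theta> m\<close> vanish at distance
  \<open>inverse (real (Suc m))\<close> or more from their centre, the second component of the
  index; the first is the level in Stone's construction. The last clause expresses the shrinking by
  open sets, so that later arguments mention no metric.\<close>

lemma metrizable_fine_partition:
  assumes "metrizable_space Y"
  obtains \<theta> :: "nat \<Rightarrow> nat \<times> 'a \<Rightarrow> 'a \<Rightarrow> real"
  where "\<And>m. locally_finite_family Y (\<theta> m)" "\<And>m i. continuous_map Y euclideanreal (\<theta> m i)"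
    "\<And>m i x. 0 \<le> \<theta> m i x"
    "\<And>m x. x \<in> topspace Y \<Longrightarrow> (\<Sum>i | \<theta> m i x \<noteq> 0. \<theta> m i x) = 1"
    "\<And>m i x. x \<in> topspace Y \<Longrightarrow> \<theta> m i x \<noteq> 0 \<Longrightarrow> snd i \<in> topspace Y"
    "\<And>x U. openin Y U \<Longrightarrow> x \<in> U \<Longrightarrow> \<forall>\<^sub>F m in sequentially. \<forall>i. \<theta> m i x \<noteq> 0 \<longrightarrow> snd i \<in> U"
proof -
  obtain M d where M: "Metric_space M d" and Y: "Y = Metric_space.mtopology M d"
    using assms unfolding metrizable_space_def by blast
  interpret Metric_space M d
    by (rule M)
  have top: "topspace Y = M"
    by (simp add: Y)
  let ?Q = "\<lambda>m (\<theta> :: nat \<times> 'a \<Rightarrow> 'a \<Rightarrow> real). locally_finite_family Y \<theta> \<and>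
      (\<forall>i. continuous_map Y euclideanreal (\<theta> i)) \<and> (\<forall>i x. 0 \<le> \<theta> i x) \<and>
      (\<forall>x\<in>M. (\<Sum>i | \<theta> i x \<noteq> 0. \<theta> i x) = 1) \<and>
      (\<forall>i. \<forall>x\<in>M. \<theta> i x \<noteq> 0 \<longrightarrow> snd i \<in> M \<and> d x (snd i) < inverse (real (Suc m)))"
  have "\<exists>\<theta>. ?Q m \<theta>" for m
  proof -
    have "0 < inverse (real (Suc m))"
      by simp
    then obtain \<phi> :: "nat \<times> 'a \<Rightarrow> 'a \<Rightarrow> real"
      where \<phi>: "locally_finite_family Y \<phi>" "\<And>i. continuous_map Y euclideanreal (\<phi> i)"
        "\<And>i x. 0 \<le> \<phi> i x" "\<And>x. x \<in> topspace Y \<Longrightarrow> \<exists>i. 0 < \<phi> i x"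
        "\<And>i x. x \<in> M \<Longrightarrow> \<phi> i x \<noteq> 0 \<Longrightarrow> snd i \<in> M \<and> d x (snd i) < inverse (real (Suc m))"
      unfolding top by (rule locally_finite_fine_family[folded Y]) blast
    obtain \<theta> where \<theta>: "locally_finite_family Y \<theta>" "\<And>i. continuous_map Y euclideanreal (\<theta> i)"
      "\<And>i x. 0 \<le> \<theta> i x" "\<And>i x. \<theta> i x \<noteq> 0 \<Longrightarrow> \<phi> i x \<noteq> 0"
      "\<And>x. x \<in> topspace Y \<Longrightarrow> (\<Sum>i | \<theta> i x \<noteq> 0. \<theta> i x) = 1"
      by (rule locally_finite_normalize[OF \<phi>(1-4)], assumption, rule that)
    show ?thesis
      by (intro exI[of _ \<theta>] conjI allI ballI impI) (use \<theta> \<phi>(5) top in simp_all)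
  qed
  then have "\<forall>m. \<exists>\<theta>. ?Q m \<theta>"
    by (rule allI)
  from choice[OF this] obtain \<theta> where "\<forall>m. ?Q m (\<theta> m)"
    by (rule exE)
  then have \<theta>: "?Q m (\<theta> m)" for m
    by (rule spec)
  have "\<forall>\<^sub>F m in sequentially. \<forall>i. \<theta> m i x \<noteq> 0 \<longrightarrow> snd i \<in> U" if "openin Y U" "x \<in> U" for x U
  proof -
    obtain r where r: "0 < r" "mball x r \<subseteq> U"
      using \<open>openin Y U\<close> \<open>x \<in> U\<close> unfolding Y openin_mtopology by blast
    have x: "x \<in> M"
      using \<open>openin Y U\<close> \<open>x \<in> U\<close> openin_subset top by blast
    have "\<forall>\<^sub>F m in sequentially. inverse (real (Suc m)) < r"
      using order_tendstoD(2)[OF LIMSEQ_inverse_real_of_nat r(1)] .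
    then show ?thesis
    proof (rule eventually_mono, intro allI impI)
      fix m i assume "inverse (real (Suc m)) < r" "\<theta> m i x \<noteq> 0"
      moreover from this have "snd i \<in> M \<and> d x (snd i) < inverse (real (Suc m))"
        using \<theta>[of m] x by blast
      ultimately have "snd i \<in> mball x r"
        using x by simp
      then show "snd i \<in> U"
        using r by blast
    qed
  qed
  then show ?thesis
    by (intro that[of \<theta>]) (use \<theta> top in auto)
qed

text \<open>Induction on \<open>n\<close> with \<open>c\<close> arbitrary, because the step uses the
  induction hypothesis at \<open>c(n := snd i)\<close> for every centre that occurs.\<close>

lemma separately_continuous_splice:
  assumes f: "separately_continuous X a f" and X: "\<And>n. metrizable_space (X n)"
    and "c \<in> sigma_prod X a"
  shows "(\<lambda>x. f (splice_at n c x)) \<in> baire_class (enat n) (sigma_top X a) euclideanreal"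
  using assms(3)
proof (induction n arbitrary: c)
  case 0
  then show ?case
    by (simp add: baire_class_enat_0 flip: zero_enat_def)
next
  case (Suc n)
  let ?E = "sigma_top X a"
  obtain \<theta> :: "nat \<Rightarrow> nat \<times> 'a \<Rightarrow> 'a \<Rightarrow> real"
    where lf: "\<And>m. locally_finite_family (X n) (\<theta> m)"
      and cont: "\<And>m i. continuous_map (X n) euclideanreal (\<theta> m i)"
      and nonneg: "\<And>m i x. 0 \<le> \<theta> m i x"
      and sum1: "\<And>m x. x \<in> topspace (X n) \<Longrightarrow> (\<Sum>i | \<theta> m i x \<noteq> 0. \<theta> m i x) = 1"
      and center: "\<And>m i x. x \<in> topspace (X n) \<Longrightarrow> \<theta> m i x \<noteq> 0 \<Longrightarrow> snd i \<in> topspace (X n)"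
      and fine: "\<And>x U. openin (X n) U \<Longrightarrow> x \<in> U \<Longrightarrow>
          \<forall>\<^sub>F m in sequentially. \<forall>i. \<theta> m i x \<noteq> 0 \<longrightarrow> snd i \<in> U"
    by (rule metrizable_fine_partition[OF X], rule that)
  define \<phi> where "\<phi> m i x = \<theta> m i (x n)" for m i and x :: "nat \<Rightarrow> 'a"
  define h where "h i x = f (splice_at n (c(n := snd i)) x)" for i :: "nat \<times> 'a" and x
  have proj: "x n \<in> topspace (X n)" if "x \<in> sigma_prod X a" for x
    using that by (auto simp: sigma_prod_def PiE_iff)
  have lf': "locally_finite_family ?E (\<phi> m)" for m
    unfolding locally_finite_family_def
  proof
    fix x assume x: "x \<in> topspace ?E"
    then have "x n \<in> topspace (X n)"
      by (simp add: proj)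
    then obtain U where U: "openin (X n) U" "x n \<in> U" "finite {i. \<exists>y\<in>U. \<theta> m i y \<noteq> 0}"
      using lf[of m] unfolding locally_finite_family_def by blast
    let ?V = "{y \<in> topspace ?E. y n \<in> U}"
    have "openin ?E ?V"
      using continuous_map_sigma_proj U(1) by (rule openin_continuous_map_preimage)
    moreover have "finite {i. \<exists>y\<in>?V. \<phi> m i y \<noteq> 0}"
      by (rule finite_subset[OF _ U(3)]) (auto simp: \<phi>_def)
    ultimately show "\<exists>U. openin ?E U \<and> x \<in> U \<and> finite {i. \<exists>y\<in>U. \<phi> m i y \<noteq> 0}"
      using x U(2) by blast
  qed
  have cont': "continuous_map ?E euclideanreal (\<phi> m i)" for m i
    using continuous_map_compose[OF continuous_map_sigma_proj[of X a n] cont]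
    by (simp add: \<phi>_def[abs_def] comp_def)
  show ?case
  proof (rule baire_class_limitI)
    show "support_sum (\<phi> m) h \<in> baire_class (enat n) ?E euclideanreal" for m
    proof (rule baire_class_support_sum[OF lf' cont'])
      fix i x assume "x \<in> topspace ?E" "\<phi> m i x \<noteq> 0"
      then have "snd i \<in> topspace (X n)"
        using center[of "x n" m i] proj by (simp add: \<phi>_def)
      then show "h i \<in> baire_class (enat n) ?E euclideanreal"
        unfolding h_def by (intro Suc.IH fun_upd_in_sigma_prod Suc.prems)
    qed
    fix x assume "x \<in> topspace ?E"
    then have x: "x \<in> sigma_prod X a"
      by simp
    let ?b = "splice_at (Suc n) c x"
    have "?b \<in> sigma_prod X a"
      using Suc.prems x by (rule splice_in_sigma_prod)
    then have tc: "topcontinuous_at (X n) euclideanreal (\<lambda>u. f (?b(n := u))) (?b n)"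
      using f by (simp add: separately_continuous_def)
    \<comment> \<open>Replacing coordinate \<open>n\<close> of \<open>?b\<close> by a centre gives
      the argument of \<open>f\<close> in \<open>h\<close>, so separate continuity at
      \<open>?b\<close> in that coordinate controls \<open>h i x\<close>.\<close>
    have b: "?b(n := u) = splice_at n (c(n := u)) x" for u
      by (auto simp: splice_at_def)
    have bn: "?b n = x n"
      by (simp add: splice_at_def)
    have "(\<lambda>m. support_sum (\<phi> m) h x) \<longlonglongrightarrow> f ?b"
    proof (rule tendstoI)
      fix e :: real assume "0 < e"
      have "openin euclideanreal (ball (f ?b) (e / 2))" "f (?b(n := ?b n)) \<in> ball (f ?b) (e / 2)"
        using \<open>0 < e\<close> by auto
      then obtain U where U: "openin (X n) U" "x n \<in> U" "\<And>u. u \<in> U \<Longrightarrow> f (?b(n := u)) \<in> ball (f ?b) (e / 2)"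
        using tc unfolding topcontinuous_at_def bn by metis
      show "\<forall>\<^sub>F m in sequentially. dist (support_sum (\<phi> m) h x) (f ?b) < e"
        using fine[OF U(1,2)]
      proof eventually_elim
        case (elim m)
        \<comment> \<open>The weights \<open>\<phi> m i x\<close> are nonnegative with sum 1 and
          every centre that occurs lies in \<open>U\<close>, so the sum is an average of values
          within \<open>e / 2\<close> of \<open>f ?b\<close>.\<close>
        let ?I = "{i. \<phi> m i x \<noteq> 0}"
        have one: "(\<Sum>i\<in>?I. \<phi> m i x) = 1"
          using sum1[OF proj[OF x]] by (simp add: \<phi>_def)
        have "support_sum (\<phi> m) h x - f ?b = (\<Sum>i\<in>?I. \<phi> m i x * h i x) - (\<Sum>i\<in>?I. \<phi> m i x) * f ?b"
          by (simp add: one support_sum_def)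
        also have "\<dots> = (\<Sum>i\<in>?I. \<phi> m i x * (h i x - f ?b))"
          by (simp add: sum_distrib_right sum_subtractf right_diff_distrib)
        finally have "\<bar>support_sum (\<phi> m) h x - f ?b\<bar> \<le> (\<Sum>i\<in>?I. \<bar>\<phi> m i x * (h i x - f ?b)\<bar>)"
          by simp
        also have "\<dots> \<le> (\<Sum>i\<in>?I. \<phi> m i x * (e / 2))"
        proof (rule sum_mono)
          fix i assume "i \<in> ?I"
          then have "\<theta> m i (x n) \<noteq> 0"
            by (simp add: \<phi>_def)
          then have "f (?b(n := snd i)) \<in> ball (f ?b) (e / 2)"
            using elim U(3) by blast
          then have "\<bar>h i x - f ?b\<bar> \<le> e / 2"
            unfolding b by (simp add: h_def dist_real_def abs_minus_commute)
          then show "\<bar>\<phi> m i x * (h i x - f ?b)\<bar> \<le> \<phi> m i x * (e / 2)"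
            using nonneg[of m i "x n"] unfolding abs_mult \<phi>_def by (intro mult_mono) auto
        qed
        also have "\<dots> = e / 2"
          unfolding sum_distrib_right[symmetric] one by simp
        finally show ?case
          using \<open>0 < e\<close> by (simp add: dist_real_def)
      qed
    qed
    then show "limitin euclideanreal (\<lambda>m. support_sum (\<phi> m) h x) (f ?b) sequentially"
      by simp
  qed simp
qed

section \<open>Stable limits of the truncated functions\<close>

theorem theorem3p3:
  fixes X :: "nat \<Rightarrow> 'a topology" and a :: "nat \<Rightarrow> 'a" and f :: "(nat \<Rightarrow> 'a) \<Rightarrow> real"
  assumes "a \<in> topspace (product_topology X UNIV)"
  shows "(strongly_separately_continuous X a f \<longrightarrow>
            f \<in> stable_baire_class (1::enat) (sigma_top X a) euclideanreal) \<and>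
         (separately_continuous X a f \<and> (\<forall>n. metrizable_space (X n)) \<longrightarrow>
            f \<in> stable_baire_class (\<infinity>::enat) (sigma_top X a) euclideanreal)"
proof -
  have a: "a \<in> sigma_prod X a"
    using assms by (simp add: sigma_prod_def)
  \<comment> \<open>The same approximants serve both parts; only their classes
    \<open>\<xi> n\<close> differ, being constantly 0 below 1 in the first part and
    \<open>enat n\<close> below \<infinity> in the second.\<close>
  have stable: "f \<in> stable_baire_class \<alpha> (sigma_top X a) euclideanreal"
    if "\<And>n. \<xi> n < \<alpha> \<and> (\<lambda>x. f (splice_at n a x)) \<in> baire_class (\<xi> n) (sigma_top X a) euclideanreal"
    for \<alpha> :: enat and \<xi>
  proof -
    have "\<exists>N. \<forall>n\<ge>N. f (splice_at n a z) = f z" if z: "z \<in> topspace (sigma_top X a)" for z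
    proof -
      obtain N where "\<And>n. n \<ge> N \<Longrightarrow> splice_at n a z = z"
        using splice_eventually_id z unfolding topspace_sigma_top by blast
      then show ?thesis
        by (intro exI[of _ N]) simp
    qed
    then show ?thesis
      unfolding stable_baire_class_def
      by (intro CollectI exI[of _ \<xi>] exI[of _ "\<lambda>n x. f (splice_at n a x)"] conjI allI ballI)
        (use that in auto)
  qed
  show ?thesis
  proof (intro conjI impI)
    assume "strongly_separately_continuous X a f"
    then show "f \<in> stable_baire_class (1::enat) (sigma_top X a) euclideanreal"
      using a by (intro stable[where \<xi> = "\<lambda>_. 0"])
        (simp add: baire_class_enat_0 strongly_separately_continuous_splice)
  next
    assume "separately_continuous X a f \<and> (\<forall>n. metrizable_space (X n))"
    then show "f \<in> stable_baire_class (\<infinity>::enat) (sigma_top X a) euclideanreal"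
      using a by (intro stable[where \<xi> = enat]) (simp add: separately_continuous_splice)
  qed
qed

end
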